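(* Let $\mathcal{S}$ be a family of maps from $[0,\infty)$ to $\mathcal{X}_2$ satisfying (S1)–(S5) and asymptotically compact in the sense of (L3), and let $\mathcal{S}$ be pointwise dissipative. Then $\mathcal{S}$ admits the global attractor $\mathcal{A}$.
   Context: Setting: $\Omega\subset\mathbb{R}^N$, $1\le N\le3$, is a bounded smooth domain, $H=L^2(\Omega)$ with norm $\|\cdot\|$, $V=H^1_0(\Omega)$, $B:V\to V'$ with $\langle Bu,v\rangle=\int_\Omega\nabla u\cdot\nabla v$. $\lambda\ge0$, $I\ni0$ is an open interval, $W\in C^{1,1}_{\rm loc}(I;\mathbb{R})$, $W'(0)=0$, $W''\ge-\lambda$ a.e. in $I$, $\lim_{r\to\partial I}W'(r)\,\mathrm{sign}\,r=+\infty$. $\mathcal{X}_2:=\{u\in H:Bu,W'(u)\in H\}$ is a complete metric space with $d_2^2(u,v)=\|u-v\|^2+\|Bu-Bv\|^2+\|(W'(u)+\lambda u)-(W'(v)+\lambda v)\|^2$ (strong topology). Weak convergence $u_n\to u$ in $\mathcal{X}_2$ means that $u_n\to u$, $Bu_n\to Bu$, $W'(u_n)+\lambda u_n\to W'(u)+\lambda u$ weakly in $H$. Properties: (S1) for all $u_0\in\mathcal{X}_2$ there is at least one $u\in\mathcal{S}$ with $u(0)=u_0$; (S2) for all $u\in\mathcal{S}$ and $T\ge0$, the map $t\mapsto u(T+t)$ belongs to $\mathcal{S}$; (S3) if $u,v\in\mathcal{S}$ and $u(T)=v(0)$ for some $T>0$, then the map equal to $u$ on $[0,T]$ and to $v(\cdot-T)$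 on $(T,\infty)$ belongs to $\mathcal{S}$; (S4) if $u,v\in\mathcal{S}$ and $u(T)=v(T)$ for some $T>0$, then $u=v$ on $[T,\infty)$; (S5) all elements of $\mathcal{S}$ are weakly continuous from $[0,\infty)$ to $\mathcal{X}_2$; and for every sequence $\{u_n\}\subset\mathcal{S}$ with $u_n(0)\to u_0$ strongly in $\mathcal{X}_2$, there exist a subsequence and $u\in\mathcal{S}$ with $u(0)=u_0$ such that, along it, $u_n(t)\to u(t)$ weakly for all $t>0$. (L3) for any sequence $\{u_n\}\subset\mathcal{S}$ with $\{u_n(0)\}$ bounded in $\mathcal{X}_2$ and any positive sequence $t_n\nearrow\infty$, the sequence $\{u_n(t_n)\}$ is precompact in $\mathcal{X}_2$ (strong topology). Pointwise dissipative: there exists a bounded $B_0\subset\mathcal{X}_2$ such that every $u\in\mathcal{S}$ satisfies $u(t)\in B_0$ for all sufficiently large $t$ (depending on $u$). $T(t)u:=\{v(t):v\in\mathcal{S},\,v(0)=u\}$, $T(t)D:=\bigcup_{u\in D}T(t)u$. Global attractor: a compact set $\mathcal{A}\subset\mathcal{X}_2$ with $T(t)\mathcal{A}=\mathcal{A}$ for all $t\ge0$ and $\lim_{t\to+\infty}\sup_{e\in T(t)D}\inf_{a\in\mathcal{A}}d_2(e,a)=0$ for every bounded $D\subset\mathcal{X}_2$. *)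

theory Defs
  imports "HOL-Analysis.Analysis"
begin

section \<open>The space \<open>L\<^sup>2(M)\<close> of classes of square-integrable functions\<close>

definition sq_integrable :: "'a measure \<Rightarrow> ('a \<Rightarrow> real) set" where
  "sq_integrable M = {f \<in> borel_measurable M. integrable M (\<lambda>x. (f x)\<^sup>2)}"

definition ae_rel :: "'a measure \<Rightarrow> (('a \<Rightarrow> real) \<times> ('a \<Rightarrow> real)) set" where
  "ae_rel M = {(f, g). f \<in> sq_integrable M \<and> g \<in> sq_integrable M \<and> (AE x in M. f x = g x)}"

definition L2 :: "'a measure \<Rightarrow> ('a \<Rightarrow> real) set set" where
  "L2 M = sq_integrable M // ae_rel M"

definition cls :: "'a measure \<Rightarrow> ('a \<Rightarrow> real) \<Rightarrow> ('a \<Rightarrow> real) set" where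
  "cls M f = ae_rel M `` {f}"

text \<open>An arbitrary representative; everything below depends on it only up to null sets.\<close>
definition rep :: "('a \<Rightarrow> real) set \<Rightarrow> 'a \<Rightarrow> real" where
  "rep u = (SOME f. f \<in> u)"

definition L2_add :: "'a measure \<Rightarrow> ('a \<Rightarrow> real) set \<Rightarrow> ('a \<Rightarrow> real) set \<Rightarrow> ('a \<Rightarrow> real) set" where
  "L2_add M u v = cls M (\<lambda>x. rep u x + rep v x)"

definition L2_diff :: "'a measure \<Rightarrow> ('a \<Rightarrow> real) set \<Rightarrow> ('a \<Rightarrow> real) set \<Rightarrow> ('a \<Rightarrow> real) set" where
  "L2_diff M u v = cls M (\<lambda>x. rep u x - rep v x)"

definition L2_scale :: "'a measure \<Rightarrow> real \<Rightarrow> ('a \<Rightarrow> real) set \<Rightarrow> ('a \<Rightarrow> real) set" where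
  "L2_scale M c u = cls M (\<lambda>x. c * rep u x)"

definition L2_inner :: "'a measure \<Rightarrow> ('a \<Rightarrow> real) set \<Rightarrow> ('a \<Rightarrow> real) set \<Rightarrow> real" where
  "L2_inner M u v = (\<integral>x. rep u x * rep v x \<partial>M)"

definition L2_norm :: "'a measure \<Rightarrow> ('a \<Rightarrow> real) set \<Rightarrow> real" where
  "L2_norm M u = sqrt (L2_inner M u u)"

text \<open>Weak convergence in \<open>L\<^sup>2(M)\<close> along a filter, by Riesz representation of the dual.\<close>
definition L2_weak_limit ::
  "'a measure \<Rightarrow> ('b \<Rightarrow> ('a \<Rightarrow> real) set) \<Rightarrow> ('a \<Rightarrow> real) set \<Rightarrow> 'b filter \<Rightarrow> bool" where
  "L2_weak_limit M f l F \<longleftrightarrow>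
     (\<forall>\<phi>\<in>L2 M. ((\<lambda>s. L2_inner M (f s) \<phi>) \<longlongrightarrow> L2_inner M l \<phi>) F)"


section \<open>Smooth functions and smooth domains\<close>

definition partial_deriv :: "'n \<Rightarrow> (real^'n \<Rightarrow> real) \<Rightarrow> real^'n \<Rightarrow> real" where
  "partial_deriv i f x = frechet_derivative f (at x) (axis i 1)"

primrec C_k :: "nat \<Rightarrow> (real^'n \<Rightarrow> real) \<Rightarrow> bool" where
  "C_k 0 f \<longleftrightarrow> continuous_on UNIV f"
| "C_k (Suc k) f \<longleftrightarrow> (\<forall>x. f differentiable (at x)) \<and> (\<forall>i. C_k k (partial_deriv i f))"

definition C_infinity :: "(real^'n \<Rightarrow> real) \<Rightarrow> bool" where
  "C_infinity f \<longleftrightarrow> (\<forall>k. C_k k f)"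

text \<open>Near each boundary point, after choosing a coordinate \<open>i\<close> and an orientation \<open>s\<close>, the
  domain is the region above the graph of a smooth function \<open>\<gamma>\<close> of the other coordinates.\<close>
definition smooth_boundary :: "(real^'n) set \<Rightarrow> bool" where
  "smooth_boundary \<Omega> \<longleftrightarrow>
     (\<forall>p\<in>frontier \<Omega>. \<exists>r>0. \<exists>i. \<exists>s\<in>{1, -1}. \<exists>\<gamma>.
        C_infinity \<gamma> \<and>
        (\<forall>y z. (\<forall>j. j \<noteq> i \<longrightarrow> y $ j = z $ j) \<longrightarrow> \<gamma> y = \<gamma> z) \<and>
        \<Omega> \<inter> ball p r = {y \<in> ball p r. \<gamma> y < s * y $ i})"

definition bounded_smooth_domain :: "(real^'n) set \<Rightarrow> bool" where
  "bounded_smooth_domain \<Omega> \<longleftrightarrow>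
     open \<Omega> \<and> connected \<Omega> \<and> \<Omega> \<noteq> {} \<and> bounded \<Omega> \<and> smooth_boundary \<Omega>"

definition test_functions :: "(real^'n) set \<Rightarrow> (real^'n \<Rightarrow> real) set" where
  "test_functions \<Omega> =
     {\<phi>. C_infinity \<phi> \<and> compact (closure {x. \<phi> x \<noteq> 0}) \<and> closure {x. \<phi> x \<noteq> 0} \<subseteq> \<Omega>}"


section \<open>The spaces \<open>H = L\<^sup>2(\<Omega>)\<close> and \<open>V = H\<^sup>1\<^sub>0(\<Omega>)\<close> and the operator \<open>B\<close>\<close>

abbreviation HH :: "(real^'n) set \<Rightarrow> (real^'n \<Rightarrow> real) set set" where
  "HH \<Omega> \<equiv> L2 (lebesgue_on \<Omega>)"

definition weak_partial ::
  "(real^'n) set \<Rightarrow> 'n \<Rightarrow> (real^'n \<Rightarrow> real) set \<Rightarrow> (real^'n \<Rightarrow> real) set \<Rightarrow> bool" where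
  "weak_partial \<Omega> i u g \<longleftrightarrow> g \<in> HH \<Omega> \<and>
     (\<forall>\<phi>\<in>test_functions \<Omega>.
        (\<integral>x. rep u x * partial_deriv i \<phi> x \<partial>lebesgue_on \<Omega>) = - (\<integral>x. rep g x * \<phi> x \<partial>lebesgue_on \<Omega>))"

definition H1 :: "(real^'n) set \<Rightarrow> (real^'n \<Rightarrow> real) set set" where
  "H1 \<Omega> = {u \<in> HH \<Omega>. \<forall>i. \<exists>g. weak_partial \<Omega> i u g}"

definition wgrad ::
  "(real^'n) set \<Rightarrow> 'n \<Rightarrow> (real^'n \<Rightarrow> real) set \<Rightarrow> (real^'n \<Rightarrow> real) set" where
  "wgrad \<Omega> i u = (SOME g. weak_partial \<Omega> i u g)"

definition H1_norm :: "(real^'n) set \<Rightarrow> (real^'n \<Rightarrow> real) set \<Rightarrow> real" where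
  "H1_norm \<Omega> u =
     sqrt ((L2_norm (lebesgue_on \<Omega>) u)\<^sup>2 + (\<Sum>i\<in>UNIV. (L2_norm (lebesgue_on \<Omega>) (wgrad \<Omega> i u))\<^sup>2))"

definition H10 :: "(real^'n) set \<Rightarrow> (real^'n \<Rightarrow> real) set set" where
  "H10 \<Omega> = {u \<in> H1 \<Omega>. \<exists>\<phi>. (\<forall>n::nat. \<phi> n \<in> test_functions \<Omega>) \<and>
     (\<lambda>n. H1_norm \<Omega> (L2_diff (lebesgue_on \<Omega>) u (cls (lebesgue_on \<Omega>) (\<phi> n)))) \<longlonglongrightarrow> 0}"

text \<open>Elements of \<open>V'\<close> are functionals on \<open>H10 \<Omega>\<close> (extended by \<open>undefined\<close>); \<open>H\<close> is embedded
  into \<open>V'\<close> through the scalar product of \<open>H\<close>, and \<open>B u \<in> H\<close> refers to this embedding.\<close>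

definition B_dual ::
  "(real^'n) set \<Rightarrow> (real^'n \<Rightarrow> real) set \<Rightarrow> (real^'n \<Rightarrow> real) set \<Rightarrow> real" where
  "B_dual \<Omega> u = (\<lambda>v\<in>H10 \<Omega>. \<Sum>i\<in>UNIV. L2_inner (lebesgue_on \<Omega>) (wgrad \<Omega> i u) (wgrad \<Omega> i v))"

definition H_to_dual ::
  "(real^'n) set \<Rightarrow> (real^'n \<Rightarrow> real) set \<Rightarrow> (real^'n \<Rightarrow> real) set \<Rightarrow> real" where
  "H_to_dual \<Omega> f = (\<lambda>v\<in>H10 \<Omega>. L2_inner (lebesgue_on \<Omega>) f v)"

definition B_in_H :: "(real^'n) set \<Rightarrow> (real^'n \<Rightarrow> real) set \<Rightarrow> bool" where
  "B_in_H \<Omega> u \<longleftrightarrow> (\<exists>f\<in>HH \<Omega>. B_dual \<Omega> u = H_to_dual \<Omega> f)"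

definition BB :: "(real^'n) set \<Rightarrow> (real^'n \<Rightarrow> real) set \<Rightarrow> (real^'n \<Rightarrow> real) set" where
  "BB \<Omega> u = (SOME f. f \<in> HH \<Omega> \<and> B_dual \<Omega> u = H_to_dual \<Omega> f)"


section \<open>The potential \<open>W\<close> and the phase space\<close>

definition C11_loc :: "real set \<Rightarrow> (real \<Rightarrow> real) \<Rightarrow> bool" where
  "C11_loc I W \<longleftrightarrow> (\<forall>r\<in>I. W differentiable (at r)) \<and>
     (\<forall>K. compact K \<and> K \<subseteq> I \<longrightarrow> (\<exists>L. L-lipschitz_on K (deriv W)))"

text \<open>The boundary of \<open>I\<close> is taken in the extended real line, so that it always consists of the
  two (possibly infinite) end points of \<open>I\<close>.\<close>
definition admissible_potential :: "real \<Rightarrow> real set \<Rightarrow> (real \<Rightarrow> real) \<Rightarrow> bool" where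
  "admissible_potential lam I W \<longleftrightarrow>
     open I \<and> is_interval I \<and> 0 \<in> I \<and> C11_loc I W \<and> deriv W 0 = 0 \<and>
     (AE r in lebesgue. r \<in> I \<longrightarrow>
        (\<exists>D. (deriv W has_real_derivative D) (at r) \<and> D \<ge> - lam)) \<and>
     (\<forall>e\<in>frontier (ereal ` I).
        filterlim (\<lambda>r. deriv W r * sgn r) at_top (filtercomap ereal (at e within ereal ` I)))"

definition W'_in_H ::
  "(real^'n) set \<Rightarrow> real set \<Rightarrow> (real \<Rightarrow> real) \<Rightarrow> (real^'n \<Rightarrow> real) set \<Rightarrow> bool" where
  "W'_in_H \<Omega> I W u \<longleftrightarrow> (AE x in lebesgue_on \<Omega>. rep u x \<in> I) \<and>
     (\<lambda>x. deriv W (rep u x)) \<in> sq_integrable (lebesgue_on \<Omega>)"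

text \<open>The class of \<open>W'(u) + \<lambda>u\<close>.\<close>
definition W'_lam ::
  "(real^'n) set \<Rightarrow> real \<Rightarrow> (real \<Rightarrow> real) \<Rightarrow> (real^'n \<Rightarrow> real) set \<Rightarrow> (real^'n \<Rightarrow> real) set" where
  "W'_lam \<Omega> lam W u =
     L2_add (lebesgue_on \<Omega>) (cls (lebesgue_on \<Omega>) (\<lambda>x. deriv W (rep u x)))
       (L2_scale (lebesgue_on \<Omega>) lam u)"

definition X2 :: "(real^'n) set \<Rightarrow> real set \<Rightarrow> (real \<Rightarrow> real) \<Rightarrow> (real^'n \<Rightarrow> real) set set" where
  "X2 \<Omega> I W = {u \<in> H10 \<Omega>. B_in_H \<Omega> u \<and> W'_in_H \<Omega> I W u}"

definition d2 ::
  "(real^'n) set \<Rightarrow> real \<Rightarrow> (real \<Rightarrow> real) \<Rightarrow> (real^'n \<Rightarrow> real) set \<Rightarrow> (real^'n \<Rightarrow> real) set \<Rightarrow> real" where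
  "d2 \<Omega> lam W u v =
     (let M = lebesgue_on \<Omega> in
      sqrt ((L2_norm M (L2_diff M u v))\<^sup>2 + (L2_norm M (L2_diff M (BB \<Omega> u) (BB \<Omega> v)))\<^sup>2
        + (L2_norm M (L2_diff M (W'_lam \<Omega> lam W u) (W'_lam \<Omega> lam W v)))\<^sup>2))"

definition X2_weak_limit ::
  "(real^'n) set \<Rightarrow> real \<Rightarrow> (real \<Rightarrow> real) \<Rightarrow> ('b \<Rightarrow> (real^'n \<Rightarrow> real) set)
     \<Rightarrow> (real^'n \<Rightarrow> real) set \<Rightarrow> 'b filter \<Rightarrow> bool" where
  "X2_weak_limit \<Omega> lam W f l F \<longleftrightarrow>
     (let M = lebesgue_on \<Omega> in
      L2_weak_limit M f l F \<and>
      L2_weak_limit M (\<lambda>s. BB \<Omega> (f s)) (BB \<Omega> l) F \<and>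
      L2_weak_limit M (\<lambda>s. W'_lam \<Omega> lam W (f s)) (W'_lam \<Omega> lam W l) F)"


text \<open>The constants of the locale \<open>Metric_space\<close> are used below for \<open>(X2, d2)\<close>.\<close>

lemma equiv_ae_rel: "equiv (sq_integrable M) (ae_rel M)"
proof (rule equivI)
  show "ae_rel M \<subseteq> sq_integrable M \<times> sq_integrable M" "refl_on (sq_integrable M) (ae_rel M)"
    by (auto simp: refl_on_def ae_rel_def)
  show "sym (ae_rel M)"
    by (auto simp: sym_def ae_rel_def eq_commute)
  show "trans (ae_rel M)"
  proof (rule transI)
    fix f g h assume "(f, g) \<in> ae_rel M" "(g, h) \<in> ae_rel M"
    moreover from this have "AE x in M. f x = g x" "AE x in M. g x = h x" by (auto simp: ae_rel_def)
    then have "AE x in M. f x = h x" by (rule eventually_elim2) simp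
    ultimately show "(f, h) \<in> ae_rel M" by (simp add: ae_rel_def)
  qed
qed

lemma cls_in_L2: "f \<in> sq_integrable M \<Longrightarrow> cls M f \<in> L2 M"
  by (auto simp: L2_def cls_def intro: quotientI)

lemma rep_mem: "u \<in> L2 M \<Longrightarrow> rep u \<in> u"
  unfolding rep_def using in_quotient_imp_non_empty[OF equiv_ae_rel] by (metis L2_def some_in_eq)

lemma rep_sq: "u \<in> L2 M \<Longrightarrow> rep u \<in> sq_integrable M"
  using rep_mem in_quotient_imp_subset[OF equiv_ae_rel] by (metis L2_def subsetD)

lemma cls_rep: assumes "u \<in> L2 M" shows "cls M (rep u) = u"
proof -
  obtain f where f: "u = ae_rel M `` {f}" using assms by (auto simp: L2_def elim: quotientE)
  then have "(f, rep u) \<in> ae_rel M" using rep_mem[OF assms] by simp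
  then show ?thesis using equiv_class_eq[OF equiv_ae_rel] f by (metis cls_def)
qed

lemma rep_cls: assumes "f \<in> sq_integrable M" shows "AE x in M. rep (cls M f) x = f x"
proof -
  have "(f, rep (cls M f)) \<in> ae_rel M" using rep_mem[OF cls_in_L2[OF assms]] by (simp add: cls_def)
  then show ?thesis by (simp add: ae_rel_def eq_commute)
qed

lemma L2_eqI: assumes "u \<in> L2 M" "v \<in> L2 M" "AE x in M. rep u x = rep v x" shows "u = v"
proof -
  have "(rep u, rep v) \<in> ae_rel M" using assms rep_sq by (auto simp: ae_rel_def)
  then have "cls M (rep u) = cls M (rep v)" unfolding cls_def by (rule equiv_class_eq[OF equiv_ae_rel])
  then show ?thesis using assms cls_rep by metis
qed

lemma sq_mult: assumes "f \<in> sq_integrable M" "g \<in> sq_integrable M" shows "integrable M (\<lambda>x. f x * g x)"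
proof (rule Bochner_Integration.integrable_bound)
  show "integrable M (\<lambda>x. (f x)\<^sup>2 + (g x)\<^sup>2)" using assms by (auto simp: sq_integrable_def)
  show "(\<lambda>x. f x * g x) \<in> borel_measurable M" using assms by (auto simp: sq_integrable_def)
  show "AE x in M. norm (f x * g x) \<le> norm ((f x)\<^sup>2 + (g x)\<^sup>2)"
  proof (rule AE_I2)
    fix x have "2 * \<bar>f x\<bar> * \<bar>g x\<bar> \<le> (f x)\<^sup>2 + (g x)\<^sup>2"
      using sum_squares_bound[of "\<bar>f x\<bar>" "\<bar>g x\<bar>"] by simp
    moreover have "0 \<le> \<bar>f x\<bar> * \<bar>g x\<bar>" by simp
    ultimately have "\<bar>f x\<bar> * \<bar>g x\<bar> \<le> (f x)\<^sup>2 + (g x)\<^sup>2" by linarith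
    then show "norm (f x * g x) \<le> norm ((f x)\<^sup>2 + (g x)\<^sup>2)" by (simp add: abs_mult)
  qed
qed

lemma sq_add: assumes "f \<in> sq_integrable M" "g \<in> sq_integrable M" shows "(\<lambda>x. a * f x + b * g x) \<in> sq_integrable M"
proof -
  have "integrable M (\<lambda>x. a\<^sup>2 * (f x)\<^sup>2 + b\<^sup>2 * (g x)\<^sup>2 + (2*a*b) * (f x * g x))"
    using assms sq_mult[OF assms] unfolding sq_integrable_def by (intro Bochner_Integration.integrable_add integrable_mult_right) auto
  then have "integrable M (\<lambda>x. (a * f x + b * g x)\<^sup>2)" by (rule back_subst[of "integrable M"]) (auto simp: power2_eq_square algebra_simps)
  then show ?thesis using assms by (auto simp: sq_integrable_def)
qed

definition sq_norm :: "'a measure \<Rightarrow> ('a \<Rightarrow> real) \<Rightarrow> real" where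
  "sq_norm M f = sqrt (\<integral>x. (f x)\<^sup>2 \<partial>M)"

lemma L2_CS: assumes "f \<in> sq_integrable M" "g \<in> sq_integrable M"
  shows "(\<integral>x. f x * g x \<partial>M) \<le> sq_norm M f * sq_norm M g"
proof -
  let ?A = "\<integral>x. (f x)\<^sup>2 \<partial>M" and ?B = "\<integral>x. (g x)\<^sup>2 \<partial>M" and ?C = "\<integral>x. f x * g x \<partial>M"
  have i: "integrable M (\<lambda>x. (f x)\<^sup>2)" "integrable M (\<lambda>x. (g x)\<^sup>2)" "integrable M (\<lambda>x. f x * g x)"
    using assms sq_mult[OF assms] by (auto simp: sq_integrable_def)
  have q: "0 \<le> a\<^sup>2 * ?A + b\<^sup>2 * ?B + (2*a*b) * ?C" for a b
  proof -
    have "0 \<le> (\<integral>x. (a * f x + b * g x)\<^sup>2 \<partial>M)" by simp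
    also have "\<dots> = (\<integral>x. a\<^sup>2 * (f x)\<^sup>2 + b\<^sup>2 * (g x)\<^sup>2 + (2*a*b) * (f x * g x) \<partial>M)"
      by (rule Bochner_Integration.integral_cong) (auto simp: power2_eq_square algebra_simps)
    also have "\<dots> = a\<^sup>2 * ?A + b\<^sup>2 * ?B + (2*a*b) * ?C" using i by simp
    finally show ?thesis .
  qed
  have A: "?A \<ge> 0" and B: "?B \<ge> 0" by auto
  have "?C\<^sup>2 \<le> ?A * ?B"
  proof (cases "?A = 0")
    case True
    have "?C = 0"
    proof (rule ccontr)
      assume "?C \<noteq> 0"
      moreover have "0 \<le> ?B + (2 * (-(?B+1) / (2 * ?C))) * ?C" using q[of "-(?B+1) / (2 * ?C)" 1] True by simp
      ultimately show False by (simp add: field_simps)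
    qed
    then show ?thesis using True by simp
  next
    case False
    then have A: "?A > 0" using A by linarith
    have "0 \<le> ?C\<^sup>2 * ?A + ?A\<^sup>2 * ?B - (2 * ?C * ?A) * ?C" using q[of "-?C" ?A] by simp
    also have "\<dots> = ?A * (?A * ?B - ?C\<^sup>2)" by (simp add: power2_eq_square algebra_simps)
    finally show ?thesis using A by (simp add: zero_le_mult_iff)
  qed
  then have "\<bar>?C\<bar> \<le> sqrt (?A * ?B)" by (metis real_sqrt_abs real_sqrt_le_mono)
  then show ?thesis by (simp add: sq_norm_def real_sqrt_mult)
qed

lemma sq_norm_add: assumes "f \<in> sq_integrable M" "g \<in> sq_integrable M"
  shows "sq_norm M (\<lambda>x. f x + g x) \<le> sq_norm M f + sq_norm M g"
proof -
  have i: "integrable M (\<lambda>x. (f x)\<^sup>2)" "integrable M (\<lambda>x. (g x)\<^sup>2)" "integrable M (\<lambda>x. f x * g x)"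
    using assms sq_mult[OF assms] by (auto simp: sq_integrable_def)
  have "(\<integral>x. (f x + g x)\<^sup>2 \<partial>M) = (\<integral>x. (f x)\<^sup>2 + (g x)\<^sup>2 + 2 * (f x * g x) \<partial>M)"
    by (rule Bochner_Integration.integral_cong) (auto simp: power2_eq_square algebra_simps)
  also have "\<dots> = (\<integral>x. (f x)\<^sup>2 \<partial>M) + (\<integral>x. (g x)\<^sup>2 \<partial>M) + 2 * (\<integral>x. f x * g x \<partial>M)" using i by simp
  also have "\<dots> \<le> (sq_norm M f)\<^sup>2 + (sq_norm M g)\<^sup>2 + 2 * (sq_norm M f * sq_norm M g)" using L2_CS[OF assms] by (simp add: sq_norm_def)
  also have "\<dots> = (sq_norm M f + sq_norm M g)\<^sup>2" by (simp add: power2_eq_square algebra_simps)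
  finally show ?thesis unfolding sq_norm_def[of M "\<lambda>x. f x + g x"]
    by (intro real_le_lsqrt) (auto simp: sq_norm_def)
qed

lemma norm_cls: assumes s: "f \<in> sq_integrable M" shows "L2_norm M (cls M f) = sq_norm M f"
proof -
  have m: "rep (cls M f) \<in> borel_measurable M" "f \<in> borel_measurable M"
    using rep_sq[OF cls_in_L2[OF s]] s by (auto simp: sq_integrable_def)
  have "(\<integral>x. rep (cls M f) x * rep (cls M f) x \<partial>M) = (\<integral>x. (f x)\<^sup>2 \<partial>M)"
    using rep_cls[OF s] m by (intro integral_cong_AE) (auto simp: power2_eq_square elim!: eventually_mono)
  then show ?thesis by (simp add: L2_norm_def L2_inner_def sq_norm_def)
qed

lemma norm_diff: assumes "u \<in> L2 M" "v \<in> L2 M"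
  shows "L2_norm M (L2_diff M u v) = sq_norm M (\<lambda>x. rep u x - rep v x)"
  using norm_cls[of "\<lambda>x. rep u x - rep v x"] sq_add[OF rep_sq rep_sq, OF assms, of 1 "-1"] by (simp add: L2_diff_def)

lemma diff_sq: assumes "u \<in> L2 M" "v \<in> L2 M" shows "(\<lambda>x. rep u x - rep v x) \<in> sq_integrable M"
  using sq_add[OF rep_sq rep_sq, OF assms, of 1 "-1"] by simp

lemma L2_triangle: assumes "u \<in> L2 M" "v \<in> L2 M" "w \<in> L2 M"
  shows "L2_norm M (L2_diff M u w) \<le> L2_norm M (L2_diff M u v) + L2_norm M (L2_diff M v w)"
  using sq_norm_add[OF diff_sq[OF assms(1,2)] diff_sq[OF assms(2,3)]] assms by (simp add: norm_diff)

lemma L2_commute: "L2_norm M (L2_diff M u v) = L2_norm M (L2_diff M v u)"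
proof (cases "(\<lambda>x. rep u x - rep v x) \<in> sq_integrable M")
  case s: True
  have s': "(\<lambda>x. rep v x - rep u x) \<in> sq_integrable M" using sq_add[OF s s, of "-1" 0] by simp
  show ?thesis by (simp add: norm_cls[OF s] norm_cls[OF s'] L2_diff_def sq_norm_def power2_commute)
next
  case n: False
  have n': "(\<lambda>x. rep v x - rep u x) \<notin> sq_integrable M"
  proof
    assume "(\<lambda>x. rep v x - rep u x) \<in> sq_integrable M"
    from sq_add[OF this this, of "-1" 0] n show False by simp
  qed
  show ?thesis using n n' by (simp add: L2_diff_def cls_def ae_rel_def)
qed

lemma L2_zero: assumes "u \<in> L2 M" "v \<in> L2 M" 
  shows "L2_norm M (L2_diff M u v) = 0 \<longleftrightarrow> u = v"
proof
  assume "L2_norm M (L2_diff M u v) = 0"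
  then have "(\<integral>x. (rep u x - rep v x)\<^sup>2 \<partial>M) = 0" using assms by (simp add: norm_diff sq_norm_def)
  moreover have "integrable M (\<lambda>x. (rep u x - rep v x)\<^sup>2)" using sq_add[OF rep_sq rep_sq, OF assms, of 1 "-1"] by (simp add: sq_integrable_def)
  ultimately have "AE x in M. (rep u x - rep v x)\<^sup>2 = 0" by (subst (asm) integral_nonneg_eq_0_iff_AE) auto
  then show "u = v" by (intro L2_eqI[OF assms]) auto
qed (use assms in \<open>simp add: norm_diff sq_norm_def\<close>)

lemma X2_in_HH: assumes "u \<in> X2 \<Omega> I W"
  shows "u \<in> HH \<Omega>" "BB \<Omega> u \<in> HH \<Omega>" "W'_lam \<Omega> lam W u \<in> HH \<Omega>"
proof -
  show u: "u \<in> HH \<Omega>" using assms by (auto simp: X2_def H10_def H1_def)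
  have "\<exists>f. f \<in> HH \<Omega> \<and> B_dual \<Omega> u = H_to_dual \<Omega> f" using assms by (auto simp: X2_def B_in_H_def)
  then show "BB \<Omega> u \<in> HH \<Omega>" unfolding BB_def by (metis (mono_tags, lifting) someI_ex)
  have s: "(\<lambda>x. lam * rep u x) \<in> sq_integrable (lebesgue_on \<Omega>)" using sq_add[OF rep_sq rep_sq, OF u u, of lam 0] by simp
  have c: "(\<lambda>x. deriv W (rep u x)) \<in> sq_integrable (lebesgue_on \<Omega>)" using assms by (auto simp: X2_def W'_in_H_def)
  show "W'_lam \<Omega> lam W u \<in> HH \<Omega>" unfolding W'_lam_def L2_add_def L2_scale_def
    using sq_add[OF rep_sq[OF cls_in_L2[OF c]] rep_sq[OF cls_in_L2[OF s]], of 1 1] by (intro cls_in_L2) simp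
qed

lemma sqrt_sum3_triangle: fixes a b c :: real assumes "0 \<le> a" "0 \<le> b" "0 \<le> c" "a \<le> a1 + a2" "b \<le> b1+b2" "c \<le> c1 + c2"
  shows "sqrt (a\<^sup>2+b\<^sup>2+c\<^sup>2) \<le> sqrt (a1\<^sup>2+b1\<^sup>2+c1\<^sup>2) + sqrt (a2\<^sup>2+b2\<^sup>2+c2\<^sup>2)"
proof -
  have e: "sqrt (x\<^sup>2+y\<^sup>2+z\<^sup>2) = norm ((x,y),z)" for x y z :: real by (simp add: norm_Pair)
  have "sqrt (a\<^sup>2+b\<^sup>2+c\<^sup>2) \<le> sqrt ((a1+a2)\<^sup>2+(b1+b2)\<^sup>2+(c1+c2)\<^sup>2)"
    using assms by (intro real_sqrt_le_mono add_mono power_mono) auto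
  also have "\<dots> = norm (((a1,b1),c1) + ((a2,b2),c2))" by (simp add: e)
  also have "\<dots> \<le> norm ((a1,b1),c1) + norm ((a2,b2),c2)" by (rule norm_triangle_ineq)
  finally show ?thesis by (simp add: e)
qed

lemma X2_Metric_space: "Metric_space (X2 \<Omega> I W) (d2 \<Omega> lam W)"
proof
  show "0 \<le> d2 \<Omega> lam W u v" for u v by (simp add: d2_def Let_def)
  show "d2 \<Omega> lam W u v = d2 \<Omega> lam W v u" for u v
    unfolding d2_def Let_def
    by (simp add: L2_commute[of _ u v] L2_commute[of _ "BB \<Omega> u" "BB \<Omega> v"]
        L2_commute[of _ "W'_lam \<Omega> lam W u" "W'_lam \<Omega> lam W v"])
next
  fix u v assume uv: "u \<in> X2 \<Omega> I W" "v \<in> X2 \<Omega> I W"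
  show "d2 \<Omega> lam W u v = 0 \<longleftrightarrow> u = v"
    using X2_in_HH(1)[OF uv(1)] X2_in_HH(1)[OF uv(2)] X2_in_HH(2)[OF uv(2)] X2_in_HH(3)[OF uv(2), of lam]
    by (auto simp: d2_def Let_def L2_zero add_nonneg_eq_0_iff)
next
  fix u v w assume uv: "u \<in> X2 \<Omega> I W" "v \<in> X2 \<Omega> I W" "w \<in> X2 \<Omega> I W"
  have n: "0 \<le> L2_norm M f" for M and f :: "(real^'n \<Rightarrow> real) set" by (simp add: L2_norm_def L2_inner_def)
  show "d2 \<Omega> lam W u w \<le> d2 \<Omega> lam W u v + d2 \<Omega> lam W v w"
    unfolding d2_def Let_def by (intro sqrt_sum3_triangle n L2_triangle X2_in_HH[OF uv(1)] X2_in_HH[OF uv(2)] X2_in_HH[OF uv(3)])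
qed


section \<open>Families of trajectories\<close>

text \<open>A map \<open>[0,\<infinity>) \<rightarrow> X\<close> is an element of \<open>{0..} \<rightarrow>\<^sub>E X\<close>, that is, a function on \<open>real\<close> with the
  fixed value \<open>undefined\<close> at negative times.\<close>

definition solvable :: "'x set \<Rightarrow> (real \<Rightarrow> 'x) set \<Rightarrow> bool" where
  "solvable X S \<longleftrightarrow> (\<forall>u0\<in>X. \<exists>u\<in>S. u 0 = u0)"

definition translation_invariant :: "(real \<Rightarrow> 'x) set \<Rightarrow> bool" where
  "translation_invariant S \<longleftrightarrow> (\<forall>u\<in>S. \<forall>T\<ge>0. (\<lambda>t\<in>{0..}. u (T + t)) \<in> S)"

definition concatenation_closed :: "(real \<Rightarrow> 'x) set \<Rightarrow> bool" where
  "concatenation_closed S \<longleftrightarrow>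
     (\<forall>u\<in>S. \<forall>v\<in>S. \<forall>T>0. u T = v 0 \<longrightarrow>
        (\<lambda>t\<in>{0..}. if t \<le> T then u t else v (t - T)) \<in> S)"

definition unique_continuation :: "(real \<Rightarrow> 'x) set \<Rightarrow> bool" where
  "unique_continuation S \<longleftrightarrow>
     (\<forall>u\<in>S. \<forall>v\<in>S. \<forall>T>0. u T = v T \<longrightarrow> (\<forall>t\<ge>T. u t = v t))"

definition weakly_continuous ::
  "(real^'n) set \<Rightarrow> real \<Rightarrow> (real \<Rightarrow> real) \<Rightarrow> (real \<Rightarrow> (real^'n \<Rightarrow> real) set) \<Rightarrow> bool" where
  "weakly_continuous \<Omega> lam W u \<longleftrightarrow>
     (\<forall>t\<ge>0. X2_weak_limit \<Omega> lam W u (u t) (at t within {0..}))"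

definition strong_weak_closed ::
  "(real^'n) set \<Rightarrow> real \<Rightarrow> real set \<Rightarrow> (real \<Rightarrow> real) \<Rightarrow> (real \<Rightarrow> (real^'n \<Rightarrow> real) set) set \<Rightarrow> bool" where
  "strong_weak_closed \<Omega> lam I W S \<longleftrightarrow>
     (\<forall>u u0. (\<forall>n::nat. u n \<in> S) \<longrightarrow>
        limitin (Metric_space.mtopology (X2 \<Omega> I W) (d2 \<Omega> lam W)) (\<lambda>n. u n 0) u0 sequentially \<longrightarrow>
        (\<exists>r::nat \<Rightarrow> nat. strict_mono r \<and>
          (\<exists>v\<in>S. v 0 = u0 \<and>
            (\<forall>t>0. X2_weak_limit \<Omega> lam W (\<lambda>k. u (r k) t) (v t) sequentially))))"

definition asymptotically_compact ::
  "'x set \<Rightarrow> ('x \<Rightarrow> 'x \<Rightarrow> real) \<Rightarrow> (real \<Rightarrow> 'x) set \<Rightarrow> bool" where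
  "asymptotically_compact X d S \<longleftrightarrow>
     (\<forall>(u :: nat \<Rightarrow> real \<Rightarrow> 'x) t.
        (\<forall>n. u n \<in> S) \<and> Metric_space.mbounded X d (range (\<lambda>n. u n 0)) \<and>
        (\<forall>n. t n > 0) \<and> incseq t \<and> filterlim t at_top sequentially \<longrightarrow>
        compactin (Metric_space.mtopology X d)
          (Metric_space.mtopology X d closure_of range (\<lambda>n. u n (t n))))"

definition pointwise_dissipative ::
  "'x set \<Rightarrow> ('x \<Rightarrow> 'x \<Rightarrow> real) \<Rightarrow> (real \<Rightarrow> 'x) set \<Rightarrow> bool" where
  "pointwise_dissipative X d S \<longleftrightarrow>
     (\<exists>B0. Metric_space.mbounded X d B0 \<and> (\<forall>u\<in>S. \<forall>\<^sub>F t in at_top. u t \<in> B0))"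

definition evol :: "(real \<Rightarrow> 'x) set \<Rightarrow> real \<Rightarrow> 'x set \<Rightarrow> 'x set" where
  "evol S t D = (\<Union>u\<in>D. {v t |v. v \<in> S \<and> v 0 = u})"

text \<open>The semidistance is computed in \<open>ennreal\<close>, where infima over the empty set are \<open>\<infinity>\<close>,
  suprema over the empty set are 0, and unbounded suprema are \<open>\<infinity>\<close>.\<close>
definition global_attractor ::
  "'x set \<Rightarrow> ('x \<Rightarrow> 'x \<Rightarrow> real) \<Rightarrow> (real \<Rightarrow> 'x) set \<Rightarrow> 'x set \<Rightarrow> bool" where
  "global_attractor X d S A \<longleftrightarrow>
     compactin (Metric_space.mtopology X d) A \<and>
     (\<forall>t\<ge>0. evol S t A = A) \<and>
     (\<forall>D. Metric_space.mbounded X d D \<longrightarrow>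
        ((\<lambda>t. SUP e\<in>evol S t D. INF a\<in>A. ennreal (d e a)) \<longlongrightarrow> 0) at_top)"

end

theory Submission
  imports Defs
begin

text \<open>The candidate attractor is the \<open>\<omega>\<close>-limit set of the unit neighbourhood \<open>B1\<close> of \<open>B0\<close>.
  By asymptotic compactness, shifts \<open>u\<^sub>n(t\<^sub>n + \<cdot>)\<close> of trajectories with bounded initial data converge
  strongly at all times \<open>\<tau> \<ge> 0\<close>, along a common subsequence, to a trajectory, since their strong
  cluster points must agree with the weak limits. Hence \<open>\<omega>\<close>-limit sets of bounded sets are compact
  and attracting, and through each of their points passes a trajectory that stays in the set and
  started a positive time earlier. The latter turns unique continuation, which holds only after positive
  times, into uniqueness of the trajectory issuing from the point, so \<open>\<omega>\<close>-limit sets are invariant.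
  Finally, each bounded \<open>D\<close> enters \<open>B1\<close> within a uniform time: otherwise trajectories avoiding \<open>B1\<close>
  on \<open>[0,n]\<close>, shifted by \<open>n/2\<close>, would converge to one that stays at distance at least 1 from \<open>B0\<close>
  forever. Therefore \<open>\<omega>(D) \<subseteq> \<omega>(B1)\<close>.\<close>

section \<open>Limits along subsequences\<close>

text \<open>If convergence fails, the indices staying outside some ball form an infinite set, and
  its enumeration has no subsequence tending to \<open>l\<close>. This yields convergence at every
  time along one fixed subsequence, without extracting anew for uncountably many times.\<close>

lemma (in Metric_space) limitin_subsubsequence:
  assumes "l \<in> M" and "\<And>n. f n \<in> M"
    and sub: "\<And>s::nat \<Rightarrow> nat. strict_mono s \<Longrightarrow>
      \<exists>s'. strict_mono s' \<and> limitin mtopology (\<lambda>k. f (s (s' k))) l sequentially"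
  shows "limitin mtopology f l sequentially"
proof (rule ccontr)
  assume "\<not> limitin mtopology f l sequentially"
  then obtain e where e: "e > 0" and inf: "\<forall>N. \<exists>n\<ge>N. \<not> d (f n) l < e"
    using assms(1,2) by (auto simp: limit_metric_sequentially)
  let ?A = "{n. \<not> d (f n) l < e}"
  have A: "infinite ?A"
    using inf by (auto simp: infinite_nat_iff_unbounded_le)
  then have "strict_mono (enumerate ?A)"
    by (rule strict_mono_enumerate)
  from sub[OF this] obtain s' where "limitin mtopology (\<lambda>k. f (enumerate ?A (s' k))) l sequentially"
    by blast
  with e obtain k where "d (f (enumerate ?A (s' k))) l < e"
    by (auto simp: limit_metric_sequentially)
  moreover have "enumerate ?A (s' k) \<in> ?A"
    using A by (rule enumerate_in_set)
  ultimately show False by simp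
qed

text \<open>\<open>asymptotically_compact\<close> asks for increasing positive times. A monotone
  subsequence of \<open>t\<close> cannot decrease, since it would be bounded above; dropping
  finitely many terms makes it positive.\<close>

lemma incseq_subseq_of_at_top:
  fixes t :: "nat \<Rightarrow> real"
  assumes t: "filterlim t at_top sequentially"
  obtains r :: "nat \<Rightarrow> nat" where "strict_mono r" "incseq (\<lambda>n. t (r n))" "\<And>n. t (r n) > 0"
proof -
  obtain r0 where r0: "strict_mono r0" "monoseq (\<lambda>n. t (r0 n))"
    using seq_monosub by blast
  have lim: "filterlim (\<lambda>n. t (r0 n)) at_top sequentially"
    using filterlim_compose[OF t filterlim_subseq[OF r0(1)]] .
  have "incseq (\<lambda>n. t (r0 n))"
  proof (rule ccontr)
    assume "\<not> incseq (\<lambda>n. t (r0 n))"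
    then have "decseq (\<lambda>n. t (r0 n))" using r0(2) by (simp add: monoseq_iff)
    then have le: "t (r0 n) \<le> t (r0 0)" for n by (simp add: decseq_def)
    have "\<forall>\<^sub>F n in sequentially. t (r0 n) > t (r0 0)"
      using lim by (simp add: filterlim_at_top_dense)
    then obtain n where "t (r0 n) > t (r0 0)" unfolding eventually_sequentially by blast
    then show False using le[of n] by simp
  qed
  moreover obtain N where "\<And>n. n \<ge> N \<Longrightarrow> t (r0 n) > 0"
    using lim unfolding filterlim_at_top_dense eventually_sequentially by blast
  ultimately have "incseq (\<lambda>n. t (r0 (n + N)))" "\<And>n. t (r0 (n + N)) > 0"
    by (auto simp: incseq_def)
  moreover have "strict_mono (\<lambda>n. r0 (n + N))"
    using r0(1) by (simp add: strict_mono_def)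
  ultimately show thesis using that by blast
qed


lemma filterlim_at_top_add_const:
  fixes t :: "'a \<Rightarrow> real"
  shows "filterlim t at_top F \<Longrightarrow> filterlim (\<lambda>x. t x + c) at_top F"
  using filterlim_tendsto_add_at_top[OF tendsto_const, of t F c] by (simp add: add.commute)


section \<open>Asymptotically compact families of trajectories\<close>

text \<open>The axiom \<open>closed\<close> keeps from weak convergence only that strong limits
  along further subsequences equal \<open>v t\<close>, so the attractor argument takes place in a
  bare metric space.\<close>

locale trajectory_family = Metric_space M d for M :: "'x set" and d +
  fixes S :: "(real \<Rightarrow> 'x) set"
  assumes maps: "S \<subseteq> ({0..} \<rightarrow>\<^sub>E M)"
    and transl: "translation_invariant S"
    and concat: "concatenation_closed S"
    and uniq: "unique_continuation S"
    and closed: "\<And>u u0. \<lbrakk>\<And>n::nat. u n \<in> S; limitin mtopology (\<lambda>n. u n 0) u0 sequentially\<rbrakk> \<Longrightarrow>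
      \<exists>r::nat \<Rightarrow> nat. strict_mono r \<and> (\<exists>v\<in>S. v 0 = u0 \<and>
        (\<forall>t>0. \<forall>s::nat \<Rightarrow> nat. \<forall>x. strict_mono s \<longrightarrow>
          limitin mtopology (\<lambda>k. u (r (s k)) t) x sequentially \<longrightarrow> v t = x))"
    and asymp: "asymptotically_compact M d S"
begin

section \<open>Strong compactness at large times\<close>

lemma in_space: "u \<in> S \<Longrightarrow> 0 \<le> t \<Longrightarrow> u t \<in> M"
  using maps by (auto simp: PiE_iff)

lemma shift: "u \<in> S \<Longrightarrow> 0 \<le> T \<Longrightarrow> (\<lambda>t\<in>{0..}. u (T + t)) \<in> S"
  using transl by (simp add: translation_invariant_def)

lemma asymptotically_compactE:
  assumes u: "\<And>n::nat. u n \<in> S" and bdd: "mbounded (range (\<lambda>n. u n 0))"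
    and t: "filterlim t at_top sequentially"
  obtains r x where "strict_mono (r :: nat \<Rightarrow> nat)"
    "limitin mtopology (\<lambda>n. u (r n) (t (r n))) x sequentially"
proof -
  obtain r0 where r0: "strict_mono r0" "incseq (\<lambda>n. t (r0 n))" "\<And>n. t (r0 n) > 0"
    using incseq_subseq_of_at_top[OF t] by blast
  let ?R = "range (\<lambda>n. u (r0 n) (t (r0 n)))"
  have "mbounded (range (\<lambda>n. u (r0 n) 0))"
    using bdd by (rule mbounded_subset) auto
  then have "compactin mtopology (mtopology closure_of ?R)"
    using asymp[unfolded asymptotically_compact_def, rule_format,
        of "\<lambda>n. u (r0 n)" "\<lambda>n. t (r0 n)"]
      u r0(2,3) filterlim_compose[OF t filterlim_subseq[OF r0(1)]] by auto
  moreover have "?R \<subseteq> mtopology closure_of ?R"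
    using in_space[OF u] r0(3) by (intro closure_of_subset) (auto simp: less_imp_le)
  ultimately obtain l r1 where "strict_mono r1"
      "limitin mtopology ((\<lambda>n. u (r0 n) (t (r0 n))) \<circ> r1) l sequentially"
    unfolding compactin_sequentially by meson
  moreover have "strict_mono (r0 \<circ> r1)"
    using r0(1) \<open>strict_mono r1\<close> by (rule strict_mono_o)
  ultimately show thesis using that[of "r0 \<circ> r1" l] by (simp add: comp_def)
qed

text \<open>Asymptotic compactness makes the shifted initial values converge, and
  \<open>closed\<close> yields \<open>w\<close>. For \<open>\<tau> > 0\<close> each further
  subsequence again has a strong cluster point at the times \<open>t n + \<tau>\<close>, and
  \<open>closed\<close> identifies all of these with \<open>w \<tau>\<close>. So one subsequence
  serves every \<open>\<tau>\<close>.\<close>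

lemma limit_trajectory:
  assumes u: "\<And>n::nat. u n \<in> S" and bdd: "mbounded (range (\<lambda>n. u n 0))"
    and t: "filterlim t at_top sequentially" and t0: "\<And>n. 0 \<le> t n"
  obtains r w where "strict_mono (r :: nat \<Rightarrow> nat)" "w \<in> S"
    "\<And>\<tau>. 0 \<le> \<tau> \<Longrightarrow> limitin mtopology (\<lambda>k. u (r k) (t (r k) + \<tau>)) (w \<tau>) sequentially"
proof -
  obtain r1 y where r1: "strict_mono r1"
    and y: "limitin mtopology (\<lambda>n. u (r1 n) (t (r1 n))) y sequentially"
    using asymptotically_compactE[OF u bdd t] by blast
  \<comment> \<open>Trajectories are \<open>undefined\<close> at negative times, so the shift is
    restricted to \<open>{0..}\<close> in order to belong to \<open>S\<close>.\<close>
  define v where "v n = (\<lambda>\<tau>\<in>{0..}. u (r1 n) (t (r1 n) + \<tau>))" for n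
  have "v n \<in> S" for n using shift[OF u t0] by (simp add: v_def)
  moreover have "limitin mtopology (\<lambda>n. v n 0) y sequentially" using y by (simp add: v_def)
  ultimately obtain r2 w where r2: "strict_mono r2" and w: "w \<in> S" "w 0 = y"
    and wlim: "\<And>\<tau> s x. \<lbrakk>0 < \<tau>; strict_mono (s :: nat \<Rightarrow> nat);
      limitin mtopology (\<lambda>k. v (r2 (s k)) \<tau>) x sequentially\<rbrakk> \<Longrightarrow> w \<tau> = x"
    using closed[of v y] by meson
  define r where "r = r1 \<circ> r2"
  have r: "strict_mono r" unfolding r_def using r1 r2 by (rule strict_mono_o)
  have "limitin mtopology (\<lambda>k. u (r k) (t (r k) + \<tau>)) (w \<tau>) sequentially" if \<tau>: "0 \<le> \<tau>" for \<tau>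
  proof (cases "\<tau> = 0")
    case True
    then show ?thesis using limitin_subsequence[OF r2 y] w(2) by (simp add: r_def comp_def)
  next
    case False
    show ?thesis
    proof (rule limitin_subsubsequence)
      show "w \<tau> \<in> M" using in_space w(1) \<tau> .
      show "u (r n) (t (r n) + \<tau>) \<in> M" for n using in_space[OF u] t0 \<tau> by simp
    next
      fix s :: "nat \<Rightarrow> nat" assume s: "strict_mono s"
      have rs: "strict_mono (r \<circ> s)" using r s by (rule strict_mono_o)
      have "filterlim (\<lambda>k. t (r (s k)) + \<tau>) at_top sequentially"
        using filterlim_compose[OF t filterlim_subseq[OF rs]]
        by (intro filterlim_at_top_add_const) (simp add: comp_def)
      moreover have "mbounded (range (\<lambda>k. u (r (s k)) 0))"
        using bdd by (rule mbounded_subset) auto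
      ultimately obtain s' x where s': "strict_mono s'"
        and x: "limitin mtopology (\<lambda>k. u (r (s (s' k))) (t (r (s (s' k))) + \<tau>)) x sequentially"
        using asymptotically_compactE[of "\<lambda>k. u (r (s k))" "\<lambda>k. t (r (s k)) + \<tau>"] u by blast
      have "w \<tau> = x"
        using False \<tau> strict_mono_o[OF s s'] x
        by (intro wlim[of \<tau> "s \<circ> s'"]) (auto simp: v_def r_def)
      then show "\<exists>s'. strict_mono s' \<and>
          limitin mtopology (\<lambda>k. u (r (s (s' k))) (t (r (s (s' k))) + \<tau>)) (w \<tau>) sequentially"
        using s' x by blast
    qed
  qed
  then show thesis using that r w(1) by blast
qed

section \<open>Omega-limit sets: invariance, compactness, attraction\<close>

text \<open>This is the usual intersection over \<open>T \<ge> 0\<close> of the closures of all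
  positions reached from \<open>D\<close> at times \<open>\<ge> T\<close>, written
  pointwise.\<close>

definition omega :: "'x set \<Rightarrow> 'x set" where
  "omega D = {x \<in> M. \<forall>e>0. \<forall>T. \<exists>v\<in>S. v 0 \<in> D \<and> (\<exists>t\<ge>T. d (v t) x < e)}"

lemma omega_subset: "omega D \<subseteq> M"
  by (auto simp: omega_def)

lemma omegaI:
  assumes u: "\<And>n::nat. u n \<in> S" "\<And>n. u n 0 \<in> D" and t: "filterlim t at_top sequentially"
    and x: "limitin mtopology (\<lambda>n. u n (t n)) x sequentially"
  shows "x \<in> omega D"
proof -
  have "\<exists>v\<in>S. v 0 \<in> D \<and> (\<exists>s\<ge>T. d (v s) x < e)" if "e > 0" for e T
  proof -
    have "\<forall>\<^sub>F n in sequentially. d (u n (t n)) x < e"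
      using x that by (auto simp: limitin_metric elim: eventually_mono)
    moreover have "\<forall>\<^sub>F n in sequentially. T \<le> t n" using t by (simp add: filterlim_at_top)
    ultimately have "\<forall>\<^sub>F n in sequentially. d (u n (t n)) x < e \<and> T \<le> t n"
      by (rule eventually_conj)
    then obtain n where "d (u n (t n)) x < e" "T \<le> t n"
      unfolding eventually_sequentially by blast
    then show ?thesis using u by blast
  qed
  then show ?thesis using x by (auto simp: omega_def limitin_metric)
qed

lemma omegaE:
  assumes x: "x \<in> omega D"
  obtains u t where "\<And>n::nat. u n \<in> S" "\<And>n. u n 0 \<in> D" "\<And>n. real n \<le> t n"
    "filterlim t at_top sequentially" "limitin mtopology (\<lambda>n. u n (t n)) x sequentially"
proof -
  have "\<forall>n. \<exists>v s. v \<in> S \<and> v 0 \<in> D \<and> real n \<le> s \<and> d (v s) x < inverse (real (Suc n))"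
  proof
    fix n
    have "0 < inverse (real (Suc n))" by simp
    then show "\<exists>v s. v \<in> S \<and> v 0 \<in> D \<and> real n \<le> s \<and> d (v s) x < inverse (real (Suc n))"
      using x unfolding omega_def by blast
  qed
  then obtain u t where u: "\<And>n. u n \<in> S \<and> u n 0 \<in> D \<and> real n \<le> t n \<and> d (u n (t n)) x < inverse (real (Suc n))"
    by metis
  have top: "filterlim t at_top sequentially"
    using filterlim_real_sequentially by (rule filterlim_at_top_mono) (use u in auto)
  have mem: "u n (t n) \<in> M" for n using u[of n] in_space by (meson of_nat_0_le_iff order_trans)
  have "(\<lambda>n. d (u n (t n)) x) \<longlonglongrightarrow> 0"
    by (rule tendsto_sandwich[OF _ _ tendsto_const LIMSEQ_inverse_real_of_nat])
      (use u in \<open>auto intro!: always_eventually less_imp_le\<close>)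
  then have "limitin mtopology (\<lambda>n. u n (t n)) x sequentially"
    using x omega_subset mem by (auto simp: limitin_metric_dist_null)
  then show thesis using that u top by blast
qed

text \<open>Observe the trajectories approaching \<open>x\<close> from \<open>s\<close> time units
  before the times \<open>t n\<close>. The limit trajectory passes through \<open>x\<close> at
  \<open>s\<close>, and each \<open>w \<tau>\<close> is still a limit at times tending to infinity,
  hence in \<open>omega D\<close>.\<close>

lemma omega_backward:
  assumes D: "mbounded D" and x: "x \<in> omega D" and s: "0 \<le> s"
  obtains w where "w \<in> S" "w s = x" "\<And>\<tau>. 0 \<le> \<tau> \<Longrightarrow> w \<tau> \<in> omega D"
proof -
  obtain u t where u: "\<And>n::nat. u n \<in> S" "\<And>n. u n 0 \<in> D" and tn: "\<And>n. real n \<le> t n"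
    and top: "filterlim t at_top sequentially"
    and lim: "limitin mtopology (\<lambda>n. u n (t n)) x sequentially"
    using omegaE[OF x] by blast
  \<comment> \<open>Dropping the first \<open>N\<close> terms gives
    \<open>t (n + N) \<ge> s\<close>, so that the shifts \<open>t'\<close> are nonnegative.\<close>
  define N where "N = nat \<lceil>s\<rceil>"
  have N: "s \<le> t (n + N)" for n
    using tn[of "n + N"] real_nat_ceiling_ge[of s] by (simp add: N_def)
  have N_mono: "strict_mono (\<lambda>n. n + N)" by (simp add: strict_mono_def)
  define t' where "t' n = t (n + N) - s" for n
  have top': "filterlim t' at_top sequentially"
    using filterlim_at_top_add_const[OF filterlim_compose[OF top filterlim_subseq[OF N_mono]], of "-s"]
    by (simp add: t'_def[abs_def])
  have bdd: "mbounded (range (\<lambda>n. u (n + N) 0))"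
    using D by (rule mbounded_subset) (use u in auto)
  obtain r w where r: "strict_mono r" and w: "w \<in> S"
    and wlim: "\<And>\<tau>. 0 \<le> \<tau> \<Longrightarrow> limitin mtopology (\<lambda>k. u (r k + N) (t' (r k) + \<tau>)) (w \<tau>) sequentially"
    using limit_trajectory[of "\<lambda>n. u (n + N)" t', OF u(1) bdd top'] N by (auto simp: t'_def)
  have "limitin mtopology (\<lambda>k. u (r k + N) (t (r k + N))) x sequentially"
    using limitin_subsequence[OF strict_mono_o[OF N_mono r] lim] by (simp add: comp_def)
  moreover have "limitin mtopology (\<lambda>k. u (r k + N) (t (r k + N))) (w s) sequentially"
    using wlim[OF s] by (simp add: t'_def)
  ultimately have "w s = x" using limitin_metric_unique trivial_limit_sequentially by blast
  moreover have "w \<tau> \<in> omega D" if "0 \<le> \<tau>" for \<tau>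
  proof (rule omegaI[of "\<lambda>k. u (r k + N)" D "\<lambda>k. t' (r k) + \<tau>", OF _ _ _ wlim[OF that]])
    show "filterlim (\<lambda>k. t' (r k) + \<tau>) at_top sequentially"
      using filterlim_compose[OF top' filterlim_subseq[OF r]] by (rule filterlim_at_top_add_const)
  qed (use u in auto)
  ultimately show thesis using that w by blast
qed

text \<open>Agreement at time 0 gives no access to \<open>uniq\<close>. Gluing \<open>v\<close>
  after a unit of past inside \<open>omega D\<close> moves the common point to time 1; from there on
  the glued map must follow \<open>w\<close>, which remains in \<open>omega D\<close>.\<close>

lemma omega_forward:
  assumes D: "mbounded D" and v: "v \<in> S" "v 0 \<in> omega D" and t: "0 \<le> t"
  shows "v t \<in> omega D"
proof -
  obtain w where w: "w \<in> S" "w 1 = v 0" "\<And>\<tau>. 0 \<le> \<tau> \<Longrightarrow> w \<tau> \<in> omega D"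
    using omega_backward[OF D v(2), of 1] by auto
  define z where "z = (\<lambda>\<tau>\<in>{0..}. if \<tau> \<le> 1 then w \<tau> else v (\<tau> - 1))"
  have "z \<in> S"
    using concat w v unfolding concatenation_closed_def z_def by force
  moreover have "z 1 = w 1" by (simp add: z_def)
  ultimately have "z (1 + t) = w (1 + t)"
    using uniq[unfolded unique_continuation_def, rule_format, of z w 1 "1 + t"] w(1) t by simp
  moreover have "z (1 + t) = v t" using t w(2) by (simp add: z_def)
  ultimately show ?thesis using w(3)[of "1 + t"] t by simp
qed

lemma evol_omega:
  assumes D: "mbounded D" and t: "0 \<le> t"
  shows "evol S t (omega D) = omega D"
proof
  show "evol S t (omega D) \<subseteq> omega D"
    using omega_forward[OF D _ _ t] by (auto simp: evol_def)
  show "omega D \<subseteq> evol S t (omega D)"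
  proof
    fix x assume "x \<in> omega D"
    \<comment> \<open>With \<open>s = t\<close> the trajectory starts in \<open>omega D\<close> and
      reaches \<open>x\<close> exactly at time \<open>t\<close>.\<close>
    obtain w where "w \<in> S" "w t = x" "\<And>\<tau>. 0 \<le> \<tau> \<Longrightarrow> w \<tau> \<in> omega D"
      using omega_backward[OF D \<open>x \<in> omega D\<close> t] by blast
    then show "x \<in> evol S t (omega D)" by (force simp: evol_def)
  qed
qed

text \<open>Replace \<open>\<sigma> n\<close> by a trajectory value \<open>u n (t n)\<close> within
  \<open>1 / (n + 1)\<close> of it, at a time at least \<open>n\<close>. A strong limit of a
  subsequence lies in \<open>omega D\<close> by \<open>omegaI\<close> and is also the limit of
  \<open>\<sigma>\<close> along it.\<close>

lemma compactin_omega: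
  assumes D: "mbounded D"
  shows "compactin mtopology (omega D)"
  unfolding compactin_sequentially
proof (intro conjI allI impI omega_subset)
  fix \<sigma> :: "nat \<Rightarrow> 'x" assume "range \<sigma> \<subseteq> omega D"
  then have \<sigma>: "\<sigma> n \<in> omega D" for n by auto
  have "\<forall>n. \<exists>v s. v \<in> S \<and> v 0 \<in> D \<and> real n \<le> s \<and> d (v s) (\<sigma> n) < inverse (real (Suc n))"
  proof
    fix n
    have "0 < inverse (real (Suc n))" by simp
    then show "\<exists>v s. v \<in> S \<and> v 0 \<in> D \<and> real n \<le> s \<and> d (v s) (\<sigma> n) < inverse (real (Suc n))"
      using \<sigma>[of n] unfolding omega_def by blast
  qed
  then obtain u t where u: "\<And>n. u n \<in> S" "\<And>n. u n 0 \<in> D" and t: "\<And>n. real n \<le> t n"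
    and close: "\<And>n. d (u n (t n)) (\<sigma> n) < inverse (real (Suc n))"
    by metis
  have top: "filterlim t at_top sequentially"
    using filterlim_real_sequentially by (rule filterlim_at_top_mono) (use t in auto)
  have mem: "u n (t n) \<in> M" for n using in_space[OF u(1)] t by (meson of_nat_0_le_iff order_trans)
  have bdd: "mbounded (range (\<lambda>n. u n 0))"
    using D by (rule mbounded_subset) (use u in auto)
  obtain r x where r: "strict_mono r"
    and x: "limitin mtopology (\<lambda>n. u (r n) (t (r n))) x sequentially"
    using asymptotically_compactE[OF u(1) bdd top] by blast
  have xM: "x \<in> M" using x by (simp add: limitin_metric)
  have "x \<in> omega D"
    by (rule omegaI[of "\<lambda>n. u (r n)" D "\<lambda>n. t (r n)", OF _ _ _ x]) (use u filterlim_compose[OF top filterlim_subseq[OF r]] in auto)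
  moreover have "limitin mtopology (\<sigma> \<circ> r) x sequentially"
    unfolding limitin_metric_dist_null
  proof (intro conjI xM)
    show "\<forall>\<^sub>F n in sequentially. (\<sigma> \<circ> r) n \<in> M" using subsetD[OF omega_subset \<sigma>] by simp
    have "d (\<sigma> (r n)) x \<le> inverse (real (Suc (r n))) + d (u (r n) (t (r n))) x" for n
    proof -
      have "d (\<sigma> (r n)) x \<le> d (\<sigma> (r n)) (u (r n) (t (r n))) + d (u (r n) (t (r n))) x"
        using triangle \<sigma> omega_subset mem xM by blast
      then show ?thesis using close[of "r n"] by (simp add: commute)
    qed
    then have bound: "norm (d ((\<sigma> \<circ> r) n) x) \<le> inverse (real (Suc (r n))) + d (u (r n) (t (r n))) x" for n
      by simp
    have "(\<lambda>n. inverse (real (Suc (r n)))) \<longlonglongrightarrow> 0"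
      using LIMSEQ_subseq_LIMSEQ[OF LIMSEQ_inverse_real_of_nat r] by (simp add: comp_def)
    moreover have "(\<lambda>n. d (u (r n) (t (r n))) x) \<longlonglongrightarrow> 0"
      using x by (simp add: limitin_metric_dist_null)
    ultimately have "(\<lambda>n. inverse (real (Suc (r n))) + d (u (r n) (t (r n))) x) \<longlonglongrightarrow> 0"
      by (rule tendsto_add_zero)
    then show "(\<lambda>n. d ((\<sigma> \<circ> r) n) x) \<longlonglongrightarrow> 0"
      by (rule Lim_null_comparison[rotated]) (rule always_eventually, rule allI, rule bound)
  qed
  ultimately show "\<exists>l r. l \<in> omega D \<and> strict_mono r \<and> limitin mtopology (\<sigma> \<circ> r) l sequentially"
    using r by blast
qed

text \<open>Otherwise trajectories from \<open>D\<close> are at least \<open>e\<close> away from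
  \<open>omega D\<close> at times tending to infinity, although a subsequence of these values has a
  limit, which lies in \<open>omega D\<close>.\<close>

lemma omega_attracts:
  assumes D: "mbounded D" and e: "0 < e"
  obtains T where "\<And>t v. \<lbrakk>T \<le> t; v \<in> S; v 0 \<in> D\<rbrakk> \<Longrightarrow> \<exists>a\<in>omega D. d (v t) a < e"
proof (rule ccontr)
  assume "\<not> thesis"
  then have "\<forall>n. \<exists>t v. real n \<le> t \<and> v \<in> S \<and> v 0 \<in> D \<and> (\<forall>a\<in>omega D. \<not> d (v t) a < e)"
    using that by meson
  then obtain t u where t: "\<And>n. real n \<le> t n" and u: "\<And>n. u n \<in> S" "\<And>n. u n 0 \<in> D"
    and far: "\<And>n a. a \<in> omega D \<Longrightarrow> \<not> d (u n (t n)) a < e"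
    by metis
  have top: "filterlim t at_top sequentially"
    using filterlim_real_sequentially by (rule filterlim_at_top_mono) (use t in auto)
  have bdd: "mbounded (range (\<lambda>n. u n 0))"
    using D by (rule mbounded_subset) (use u in auto)
  obtain r x where r: "strict_mono r"
    and x: "limitin mtopology (\<lambda>n. u (r n) (t (r n))) x sequentially"
    using asymptotically_compactE[OF u(1) bdd top] by blast
  have "x \<in> omega D"
    by (rule omegaI[of "\<lambda>n. u (r n)" D "\<lambda>n. t (r n)", OF _ _ _ x]) (use u filterlim_compose[OF top filterlim_subseq[OF r]] in auto)
  moreover have "\<exists>n. d (u (r n) (t (r n))) x < e"
    using x e by (auto simp: limit_metric_sequentially)
  ultimately show False using far by blast
qed

section \<open>Uniform absorption and existence of the attractor\<close>

text \<open>Pointwise dissipativity is applied to the limit \<open>w\<close> of trajectories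
  avoiding the neighbourhood for longer and longer; convergence at one time \<open>\<tau>\<close>
  with \<open>w \<tau> \<in> B0\<close> contradicts this. Convergence only brings values within
  distance 1 of \<open>B0\<close>, not into \<open>B0\<close> itself.\<close>

lemma uniform_entry_time:
  assumes B0: "B0 \<subseteq> M" and diss: "\<And>u. u \<in> S \<Longrightarrow> \<forall>\<^sub>F t in at_top. u t \<in> B0"
    and D: "mbounded D"
  obtains T where "\<And>v. \<lbrakk>v \<in> S; v 0 \<in> D\<rbrakk> \<Longrightarrow> \<exists>t. 0 \<le> t \<and> t \<le> T \<and> (\<exists>b\<in>B0. d (v t) b < 1)"
proof (rule ccontr)
  assume "\<not> thesis"
  then have "\<forall>n::nat. \<exists>v. v \<in> S \<and> v 0 \<in> D \<and> (\<forall>t b. 0 \<le> t \<and> t \<le> real n \<and> b \<in> B0 \<longrightarrow> \<not> d (v t) b < 1)"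
    using that by meson
  then obtain u where u: "\<And>n::nat. u n \<in> S" "\<And>n. u n 0 \<in> D"
    and far: "\<And>n t b. \<lbrakk>0 \<le> t; t \<le> real n; b \<in> B0\<rbrakk> \<Longrightarrow> \<not> d (u n t) b < 1"
    by metis
  \<comment> \<open>Shifting by \<open>n / 2\<close> sends the shift times to infinity and still
    leaves a window of length \<open>n / 2\<close> for \<open>\<tau>\<close>.\<close>
  have half: "filterlim (\<lambda>n. real n / 2) at_top sequentially"
    using filterlim_tendsto_pos_mult_at_top[OF tendsto_const[of "1/2"] _ filterlim_real_sequentially] by simp
  have bdd: "mbounded (range (\<lambda>n. u n 0))"
    using D by (rule mbounded_subset) (use u in auto)
  obtain r w where r: "strict_mono r" and w: "w \<in> S"
    and wlim: "\<And>\<tau>. 0 \<le> \<tau> \<Longrightarrow> limitin mtopology (\<lambda>k. u (r k) (real (r k) / 2 + \<tau>)) (w \<tau>) sequentially"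
    using limit_trajectory[OF u(1) bdd half] by auto
  have "\<forall>\<^sub>F \<tau> in at_top. w \<tau> \<in> B0 \<and> 0 \<le> \<tau>"
    using diss[OF w] eventually_ge_at_top by (rule eventually_conj)
  then obtain \<tau> where \<tau>: "w \<tau> \<in> B0" "0 \<le> \<tau>"
    unfolding eventually_at_top_linorder by blast
  have "\<forall>\<^sub>F k in sequentially. d (u (r k) (real (r k) / 2 + \<tau>)) (w \<tau>) < 1"
    using wlim[OF \<tau>(2)] by (auto simp: limitin_metric elim!: allE[of _ 1] eventually_mono)
  moreover have "\<forall>\<^sub>F k in sequentially. \<tau> \<le> real (r k) / 2"
    using filterlim_compose[OF half filterlim_subseq[OF r]] by (simp add: filterlim_at_top)
  ultimately have "\<forall>\<^sub>F k in sequentially. d (u (r k) (real (r k) / 2 + \<tau>)) (w \<tau>) < 1 \<and> \<tau> \<le> real (r k) / 2"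
    by (rule eventually_conj)
  then obtain k where "d (u (r k) (real (r k) / 2 + \<tau>)) (w \<tau>) < 1" "\<tau> \<le> real (r k) / 2"
    unfolding eventually_sequentially by blast
  then show False using far[of "real (r k) / 2 + \<tau>" "r k" "w \<tau>"] \<tau> by simp
qed

text \<open>A trajectory from \<open>D\<close> is restarted at its entry time into \<open>B\<close>;
  this costs at most \<open>T\<close> before the late visits near \<open>x\<close>.\<close>

lemma omega_subset_omega:
  assumes enter: "\<And>v. \<lbrakk>v \<in> S; v 0 \<in> D\<rbrakk> \<Longrightarrow> \<exists>t. 0 \<le> t \<and> t \<le> T \<and> v t \<in> B"
  shows "omega D \<subseteq> omega B"
proof
  fix x assume x: "x \<in> omega D"
  have "\<exists>v\<in>S. v 0 \<in> B \<and> (\<exists>t\<ge>T'. d (v t) x < e)" if e: "0 < e" for e T'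
  proof -
    \<comment> \<open>The term \<open>max T' 0\<close> leaves \<open>t - s\<close> both above
      \<open>T'\<close> and nonnegative, as the restricted shift requires.\<close>
    obtain v t where v: "v \<in> S" "v 0 \<in> D" and t: "T + max T' 0 \<le> t" "d (v t) x < e"
      using x e unfolding omega_def by blast
    obtain s where s: "0 \<le> s" "s \<le> T" "v s \<in> B" using enter[OF v] by blast
    let ?w = "\<lambda>t\<in>{0..}. v (s + t)"
    have "?w \<in> S" using shift[OF v(1) s(1)] .
    moreover have "?w 0 \<in> B" using s by simp
    moreover have "T' \<le> t - s" "d (?w (t - s)) x < e" using t s by auto
    ultimately show ?thesis by blast
  qed
  then show "x \<in> omega B" using x by (auto simp: omega_def)
qed

theorem ex_global_attractor:
  assumes diss: "pointwise_dissipative M d S"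
  shows "\<exists>A. global_attractor M d S A"
proof -
  obtain B0 where B0: "mbounded B0" "\<And>u. u \<in> S \<Longrightarrow> \<forall>\<^sub>F t in at_top. u t \<in> B0"
    using diss unfolding pointwise_dissipative_def by blast
  have B0M: "B0 \<subseteq> M" using B0(1) by (rule mbounded_subset_mspace)
  \<comment> \<open>The radius 1 is that of \<open>uniform_entry_time\<close>; enlarging
    \<open>B0\<close> in this way adds at most 2 to the bound on distances.\<close>
  define B where "B = {x \<in> M. \<exists>b\<in>B0. d x b < 1}"
  have B: "mbounded B"
  proof -
    obtain c where c: "\<And>x y. \<lbrakk>x \<in> B0; y \<in> B0\<rbrakk> \<Longrightarrow> d x y \<le> c"
      using B0(1) by (auto simp: mbounded_alt)
    have "d x y \<le> c + 2" if xyB: "x \<in> B" "y \<in> B" for x y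
    proof -
      obtain a b where ab: "a \<in> B0" "b \<in> B0" "d x a < 1" "d y b < 1" and xy: "x \<in> M" "y \<in> M"
        using xyB unfolding B_def by blast
      have "d x y \<le> d x a + d a y" "d a y \<le> d a b + d b y"
        using triangle xy ab B0M by blast+
      then show ?thesis using ab c[OF ab(1,2)] by (simp add: commute)
    qed
    then show ?thesis by (auto simp: mbounded_alt B_def)
  qed
  have sub: "omega D \<subseteq> omega B" if D: "mbounded D" for D
  proof -
    obtain T where "\<And>v. \<lbrakk>v \<in> S; v 0 \<in> D\<rbrakk> \<Longrightarrow> \<exists>t. 0 \<le> t \<and> t \<le> T \<and> (\<exists>b\<in>B0. d (v t) b < 1)"
      using uniform_entry_time[OF B0M B0(2) D] by blast
    then have "\<exists>t. 0 \<le> t \<and> t \<le> T \<and> v t \<in> B" if "v \<in> S" "v 0 \<in> D" for v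
      using that in_space[OF that(1)] unfolding B_def by blast
    then show ?thesis by (rule omega_subset_omega)
  qed
  \<comment> \<open>The set \<open>D\<close> is attracted by its own \<open>omega D\<close>, which
    lies in \<open>omega B\<close>.\<close>
  have "((\<lambda>t. SUP e\<in>evol S t D. INF a\<in>omega B. ennreal (d e a)) \<longlongrightarrow> 0) at_top" if D: "mbounded D" for D
    unfolding order_tendsto_iff
  proof (intro conjI allI impI)
    fix \<epsilon> :: ennreal assume "0 < \<epsilon>"
    \<comment> \<open>Here \<open>\<epsilon>\<close> may be infinite; anything strictly below it is
      finite and supplies a real \<open>e'\<close>.\<close>
    then obtain e where "0 < e" "e < \<epsilon>" using dense by blast
    then obtain e' where e': "0 < e'" "ennreal e' < \<epsilon>"
      by (cases e) auto
    obtain T where T: "\<And>t v. \<lbrakk>T \<le> t; v \<in> S; v 0 \<in> D\<rbrakk> \<Longrightarrow> \<exists>a\<in>omega D. d (v t) a < e'"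
      using omega_attracts[OF D e'(1)] by blast
    have "(SUP e\<in>evol S t D. INF a\<in>omega B. ennreal (d e a)) \<le> ennreal e'" if le: "T \<le> t" for t
    proof (rule SUP_least)
      fix y assume "y \<in> evol S t D"
      then obtain v where "v \<in> S" "v 0 \<in> D" "y = v t" by (auto simp: evol_def)
      then obtain a where "a \<in> omega B" "d y a < e'" using T[OF le] sub[OF D] by blast
      then show "(INF a\<in>omega B. ennreal (d y a)) \<le> ennreal e'"
        by (intro INF_lower2[of a] ennreal_leI) auto
    qed
    then show "\<forall>\<^sub>F t in at_top. (SUP e\<in>evol S t D. INF a\<in>omega B. ennreal (d e a)) < \<epsilon>"
      using e'(2) by (auto simp: eventually_at_top_linorder intro: le_less_trans)
  qed simp
  then have "global_attractor M d S (omega B)"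
    using compactin_omega[OF B] evol_omega[OF B] by (simp add: global_attractor_def)
  then show ?thesis ..
qed

end

section \<open>Uniqueness of the attractor\<close>

text \<open>Being compact, \<open>A\<close> is bounded and thus attracted by \<open>A'\<close>;
  being invariant, it has a semidistance to \<open>A'\<close> that is constant in time, hence 0.
  Since \<open>A'\<close> is closed, the inclusion follows, and exchanging the two attractors gives
  equality.\<close>

lemma global_attractor_subset:
  assumes ms: "Metric_space M d"
    and A: "global_attractor M d S A" and A': "global_attractor M d S A'"
  shows "A \<subseteq> A'"
proof
  interpret Metric_space M d by (fact ms)
  fix x assume x: "x \<in> A"
  have cA: "compactin mtopology A" and cA': "compactin mtopology A'"
    using A A' by (auto simp: global_attractor_def)
  have bdd: "mbounded A" using cA by (rule compactin_imp_mbounded)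
  have "((\<lambda>t. SUP e\<in>evol S t A. INF a\<in>A'. ennreal (d e a)) \<longlongrightarrow> 0) at_top"
    using A' bdd by (simp add: global_attractor_def)
  moreover have "\<forall>\<^sub>F t in at_top. (SUP e\<in>evol S t A. INF a\<in>A'. ennreal (d e a))
      = (SUP e\<in>A. INF a\<in>A'. ennreal (d e a))"
    using eventually_ge_at_top[of 0]
    by (rule eventually_mono) (use A in \<open>simp add: global_attractor_def\<close>)
  ultimately have "((\<lambda>t::real. SUP e\<in>A. INF a\<in>A'. ennreal (d e a)) \<longlongrightarrow> 0) at_top"
    using tendsto_cong by fastforce
  then have "(SUP e\<in>A. INF a\<in>A'. ennreal (d e a)) = 0"
    by (simp add: tendsto_const_iff)
  then have zero: "(INF a\<in>A'. ennreal (d x a)) = 0"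
    using x by (metis SUP_upper le_zero_eq)
  have xM: "x \<in> M" using cA x by (auto simp: compactin_sequentially)
  have "closedin mtopology A'"
    using compactin_imp_closedin[OF Hausdorff_space_mtopology cA'] .
  show "x \<in> A'"
  proof (rule ccontr)
    assume "x \<notin> A'"
    then obtain e where e: "0 < e" "disjnt A' (mball x e)"
      using \<open>closedin mtopology A'\<close> xM unfolding closedin_metric by blast
    have "ennreal e \<le> (INF a\<in>A'. ennreal (d x a))"
    proof (rule INF_greatest)
      fix a assume a: "a \<in> A'"
      then have "a \<in> M" using cA' by (auto simp: compactin_sequentially)
      then have "\<not> d x a < e" using e a xM by (auto simp: disjnt_iff)
      then show "ennreal e \<le> ennreal (d x a)" by (simp add: ennreal_leI)
    qed
    then show False using zero e by simp
  qed
qed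


section \<open>Weak limits of strongly convergent sequences\<close>

text \<open>Test with \<open>\<phi> = y - x\<close>: by Cauchy-Schwarz the strong limit gives the
  inner products the limit \<open>L2_inner M x \<phi>\<close>, while the weak limit gives
  \<open>L2_inner M y \<phi>\<close>. Equality of the two makes the norm of \<open>y - x\<close>
  vanish.\<close>

lemma L2_weak_limit_unique:
  assumes L2: "\<And>n. f n \<in> L2 M" "x \<in> L2 M" "y \<in> L2 M"
    and strong: "(\<lambda>n. L2_norm M (L2_diff M (f n) x)) \<longlonglongrightarrow> 0"
    and weak: "L2_weak_limit M f y sequentially"
  shows "y = x"
proof -
  have sq: "rep v \<in> sq_integrable M" if "v \<in> L2 M" for v using that by (rule rep_sq)
  define \<phi> where "\<phi> = L2_diff M y x"
  have \<phi>: "\<phi> \<in> L2 M" unfolding \<phi>_def L2_diff_def using L2 by (intro cls_in_L2 diff_sq)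
  have bound: "\<bar>L2_inner M v \<phi> - L2_inner M x \<phi>\<bar> \<le> L2_norm M (L2_diff M v x) * sq_norm M (rep \<phi>)"
    if v: "v \<in> L2 M" for v
  proof -
    \<comment> \<open>\<open>L2_CS\<close> is one-sided, so both signs of the difference are used to
      bound the absolute value.\<close>
    have d: "(\<lambda>z. rep v z - rep x z) \<in> sq_integrable M"
      "(\<lambda>z. rep x z - rep v z) \<in> sq_integrable M"
      using v L2 by (auto intro: diff_sq)
    have eq: "(\<integral>z. (rep v z - rep x z) * rep \<phi> z \<partial>M) = L2_inner M v \<phi> - L2_inner M x \<phi>"
      "(\<integral>z. (rep x z - rep v z) * rep \<phi> z \<partial>M) = L2_inner M x \<phi> - L2_inner M v \<phi>"
      using v L2 \<phi> by (simp_all add: L2_inner_def left_diff_distrib sq_mult sq)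
    have "sq_norm M (\<lambda>z. rep x z - rep v z) = sq_norm M (\<lambda>z. rep v z - rep x z)"
      by (simp add: sq_norm_def power2_commute)
    then show ?thesis
      using L2_CS[OF d(1) sq[OF \<phi>]] L2_CS[OF d(2) sq[OF \<phi>]] v L2
      unfolding eq by (simp add: norm_diff)
  qed
  have "(\<lambda>n. L2_norm M (L2_diff M (f n) x) * sq_norm M (rep \<phi>)) \<longlonglongrightarrow> 0"
    using tendsto_mult_right[OF strong, of "sq_norm M (rep \<phi>)"] by simp
  then have "(\<lambda>n. L2_inner M (f n) \<phi> - L2_inner M x \<phi>) \<longlonglongrightarrow> 0"
    by (rule Lim_null_comparison[rotated]) (use bound[OF L2(1)] in auto)
  then have "(\<lambda>n. L2_inner M (f n) \<phi>) \<longlonglongrightarrow> L2_inner M x \<phi>"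
    by (rule LIM_zero_cancel)
  moreover have "(\<lambda>n. L2_inner M (f n) \<phi>) \<longlonglongrightarrow> L2_inner M y \<phi>"
    using weak \<phi> by (simp add: L2_weak_limit_def)
  ultimately have "L2_inner M x \<phi> = L2_inner M y \<phi>"
    by (rule LIMSEQ_unique)
  then have "(\<integral>z. (rep y z - rep x z) * rep \<phi> z \<partial>M) = 0"
    using L2 \<phi> by (simp add: L2_inner_def left_diff_distrib sq_mult sq)
  \<comment> \<open>\<open>rep \<phi>\<close> agrees with the difference of the representatives only
    almost everywhere.\<close>
  moreover have "(\<integral>z. (rep y z - rep x z) * rep \<phi> z \<partial>M) = (\<integral>z. rep \<phi> z * rep \<phi> z \<partial>M)"
  proof (rule integral_cong_AE)
    show "AE z in M. (rep y z - rep x z) * rep \<phi> z = rep \<phi> z * rep \<phi> z"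
      using rep_cls[OF diff_sq[OF L2(3,2)]] by (auto simp: \<phi>_def L2_diff_def)
  qed (use sq[OF L2(2)] sq[OF L2(3)] sq[OF \<phi>] in \<open>auto simp: sq_integrable_def\<close>)
  ultimately have "L2_norm M \<phi> = 0" by (simp add: L2_norm_def L2_inner_def)
  then show ?thesis using L2_zero[OF L2(3,2)] by (simp add: \<phi>_def)
qed

text \<open>A point of \<open>X2\<close> is itself a class in \<open>H\<close>, so it suffices to
  compare the limits there: \<open>d2\<close> dominates the distance of \<open>H\<close>.\<close>

lemma X2_weak_limit_unique:
  assumes X2: "\<And>n. f n \<in> X2 \<Omega> I W" "y \<in> X2 \<Omega> I W"
    and strong: "limitin (Metric_space.mtopology (X2 \<Omega> I W) (d2 \<Omega> lam W)) f x sequentially"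
    and weak: "X2_weak_limit \<Omega> lam W f y sequentially"
  shows "y = x"
proof (rule L2_weak_limit_unique)
  interpret Metric_space "X2 \<Omega> I W" "d2 \<Omega> lam W" by (rule X2_Metric_space)
  show "f n \<in> HH \<Omega>" for n using X2(1) by (rule X2_in_HH)
  show "y \<in> HH \<Omega>" using X2(2) by (rule X2_in_HH)
  show "x \<in> HH \<Omega>" using strong X2_in_HH by (auto simp: limitin_metric)
  show "L2_weak_limit (lebesgue_on \<Omega>) f y sequentially"
    using weak by (simp add: X2_weak_limit_def Let_def)
  have "(\<lambda>n. d2 \<Omega> lam W (f n) x) \<longlonglongrightarrow> 0"
    using strong by (simp add: limitin_metric_dist_null)
  then show "(\<lambda>n. L2_norm (lebesgue_on \<Omega>) (L2_diff (lebesgue_on \<Omega>) (f n) x)) \<longlonglongrightarrow> 0"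
  proof (rule Lim_null_comparison[rotated], intro always_eventually allI)
    fix n
    have "0 \<le> L2_norm (lebesgue_on \<Omega>) (L2_diff (lebesgue_on \<Omega>) (f n) x)"
      by (simp add: L2_norm_def L2_inner_def)
    then show "norm (L2_norm (lebesgue_on \<Omega>) (L2_diff (lebesgue_on \<Omega>) (f n) x)) \<le> d2 \<Omega> lam W (f n) x"
      by (auto simp: d2_def Let_def intro!: real_le_rsqrt)
  qed
qed

lemma X2_weak_limit_subseq:
  assumes "strict_mono s" "X2_weak_limit \<Omega> lam W f l sequentially"
  shows "X2_weak_limit \<Omega> lam W (\<lambda>k. f (s k)) l sequentially"
  using assms(2) unfolding X2_weak_limit_def L2_weak_limit_def Let_def
  by (auto intro!: filterlim_compose[OF _ filterlim_subseq[OF assms(1)]])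

section \<open>Application to the phase space \<open>X2\<close>\<close>

theorem proposition7p3:
  fixes \<Omega> :: "(real^'n) set"
    and lam :: real
    and I :: "real set"
    and W :: "real \<Rightarrow> real"
    and S :: "(real \<Rightarrow> (real^'n \<Rightarrow> real) set) set"
  assumes "CARD('n) \<le> 3"
    and "bounded_smooth_domain \<Omega>"
    and "lam \<ge> 0"
    and "admissible_potential lam I W"
    and "S \<subseteq> ({0..} \<rightarrow>\<^sub>E X2 \<Omega> I W)"
    and "solvable (X2 \<Omega> I W) S"
    and "translation_invariant S"
    and "concatenation_closed S"
    and "unique_continuation S"
    and "\<forall>u\<in>S. weakly_continuous \<Omega> lam W u"
    and "strong_weak_closed \<Omega> lam I W S"
    and "asymptotically_compact (X2 \<Omega> I W) (d2 \<Omega> lam W) S"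
    and "pointwise_dissipative (X2 \<Omega> I W) (d2 \<Omega> lam W) S"
  shows "\<exists>!A. global_attractor (X2 \<Omega> I W) (d2 \<Omega> lam W) S A"
proof -
  interpret Metric_space "X2 \<Omega> I W" "d2 \<Omega> lam W" by (rule X2_Metric_space)
  have in_X2: "v t \<in> X2 \<Omega> I W" if "v \<in> S" "0 \<le> t" for v t
    using assms(5) that by (auto simp: PiE_iff)
  \<comment> \<open>The obligation that needs an argument is \<open>closed\<close>: weak convergence
    passes to further subsequences, along which a strong limit must coincide with the weak
    one.\<close>
  interpret trajectory_family "X2 \<Omega> I W" "d2 \<Omega> lam W" S
  proof
    fix u u0 assume u: "\<And>n::nat. u n \<in> S" "limitin mtopology (\<lambda>n. u n 0) u0 sequentially"
    then obtain r v where r: "strict_mono r" and v: "v \<in> S" "v 0 = u0"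
      and weak: "\<And>t. 0 < t \<Longrightarrow> X2_weak_limit \<Omega> lam W (\<lambda>k. u (r k) t) (v t) sequentially"
      using assms(11)[unfolded strong_weak_closed_def, rule_format, OF u] by blast
    have "v t = x" if t: "0 < t" and s: "strict_mono (s :: nat \<Rightarrow> nat)"
      and lim: "limitin mtopology (\<lambda>k. u (r (s k)) t) x sequentially" for t s x
    proof (rule X2_weak_limit_unique[OF _ _ lim])
      show "X2_weak_limit \<Omega> lam W (\<lambda>k. u (r (s k)) t) (v t) sequentially"
        using X2_weak_limit_subseq[OF s weak[OF t]] .
    qed (use in_X2 u v t in auto)
    then show "\<exists>r::nat \<Rightarrow> nat. strict_mono r \<and> (\<exists>v\<in>S. v 0 = u0 \<and>
        (\<forall>t>0. \<forall>s::nat \<Rightarrow> nat. \<forall>x. strict_mono s \<longrightarrow>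
          limitin mtopology (\<lambda>k. u (r (s k)) t) x sequentially \<longrightarrow> v t = x))"
      by (intro exI[of _ r] conjI bexI[of _ v] allI impI r v) assumption+
  qed (fact assms)+
  show ?thesis
    using ex_global_attractor[OF assms(13)] global_attractor_subset[OF X2_Metric_space] by blast
qed

end
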